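(* Let $A$ be a g-alternative algebra over a field $F$. Then $\mathrm{Asoci}(A)$ is a $\mathfrak{B}(A)$-substructure of $A$.
   Context: Algebras: an algebra over a field $F$ is an $F$-vector space with an $F$-bilinear multiplication, not assumed associative or unital. $A$ is g-alternative if for all $x,y,z\in A$: $x(yz)=(xy)z+(yx)z-y(xz)$ and $(xy)z=x(yz)+x(zy)-(xz)y$. Derived actions: a derived action in $\mathrm{gAlt}$ (the category of g-alternative algebras over $F$) of a g-alternative algebra $B$ on a g-alternative algebra $A$ is a pair of $F$-bilinear maps $B\times A\to A$, $(b,a)\mapsto ba$, and $A\times B\to A$, $(a,b)\mapsto ab$, such that for all $a,a_1,a_2\in A$, $b,b_1,b_2\in B$: $b(a_1a_2)=(ba_1)a_2+(a_1b)a_2-a_1(ba_2)$; $(a_1a_2)b=a_1(a_2b)+a_1(ba_2)-(a_1b)a_2$; $(ba_1)a_2=b(a_1a_2)+b(a_2a_1)-(ba_2)a_1$; $a_1(a_2b)=(a_1a_2)b+(a_2a_1)b-a_2(a_1b)$; $(b_1b_2)a=b_1(b_2a)+b_1(ab_2)-(b_1a)b_2$; $a(b_1b_2)=(ab_1)b_2+(b_1a)b_2-b_1(ab_2)$; $(ab_1)b_2=a(b_1b_2)+a(b_2b_1)-(ab_2)b_1$; $b_1(b_2a)=(b_1b_2)a+(b_2b_1)a-b_2(b_1a)$. ($A$ acts on itself by multiplication.) Let $\{B_i\}_{i\in I}$ be the family of all g-alternative algebras equipped with a derived action on $A$ in $\mathrm{gAlt}$. $\mathfrak{B}(A)$: for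 a pair $f$ of $F$-linear maps $A\to A$ write $fa$ for the value of the first map at $a$ and $af$ for the value of the second. Each $b\in B_i$ gives the pair $(a\mapsto ba,\ a\mapsto ab)$; let $\mathbb{B}$ be the set of all pairs so obtained. On pairs define addition componentwise and a product $ff'$ by $(ff')a=f(f'a)+f(af')-(fa)f'$, $a(ff')=(af)f'+(fa)f'-f(af')$. Then $\mathfrak{B}(A)$ (the universal strict general actor of $A$) is the $F$-algebra of all pairs obtained from elements of $\mathbb{B}$ by repeatedly applying addition, negation and this product (pairs giving the same maps are identified). It acts on $A$ by $(f,a)\mapsto fa$, $(a,f)\mapsto af$. Substructure: a $\mathfrak{B}(A)$-substructure of $A$ is a subalgebra $A'\subseteq A$ with $fa\in A'$ and $af\in A'$ for all $f\in\mathfrak{B}(A)$, $a\in A'$. $\mathrm{Soci}(A)$ is the $\mathfrak{B}(A)$-substructure of $A$ generated by all elements of the forms $x(yz)+x(zy)$ and $(yz)x+(zy)x$ in which one of $x,y,z$ lies in $\bigcup_{i\in I}B_i$ and the other two lie in $A$. For $n\ge1$, $\mathrm{Asoci}^n(A)=\{x\in A\mid (\dots((xa_1)a_2)\dots)a_n\in\mathrm{Soci}(A)\text{ for all }a_1,\dots,a_n\in A\}$, and $\mathrm{Asoci}(A)=\bigcup_{n\ge1}\mathrm{Asoci}^n(A)$. *)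

theory Defs
  imports "HOL-Algebra.Module"
begin

definition bilinear_map ::
  "('f, 'm) ring_scheme \<Rightarrow> ('f, 'a, 'p) module_scheme \<Rightarrow> ('f, 'b, 'q) module_scheme \<Rightarrow>
   ('f, 'c, 'r) module_scheme \<Rightarrow> ('a \<Rightarrow> 'b \<Rightarrow> 'c) \<Rightarrow> bool" where
  "bilinear_map F U V W h \<longleftrightarrow>
     (\<forall>u\<in>carrier U. \<forall>v\<in>carrier V. h u v \<in> carrier W) \<and>
     (\<forall>u\<in>carrier U. \<forall>u'\<in>carrier U. \<forall>v\<in>carrier V.
        h (u \<oplus>\<^bsub>U\<^esub> u') v = h u v \<oplus>\<^bsub>W\<^esub> h u' v) \<and>
     (\<forall>u\<in>carrier U. \<forall>v\<in>carrier V. \<forall>v'\<in>carrier V.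
        h u (v \<oplus>\<^bsub>V\<^esub> v') = h u v \<oplus>\<^bsub>W\<^esub> h u v') \<and>
     (\<forall>c\<in>carrier F. \<forall>u\<in>carrier U. \<forall>v\<in>carrier V.
        h (c \<odot>\<^bsub>U\<^esub> u) v = c \<odot>\<^bsub>W\<^esub> h u v \<and>
        h u (c \<odot>\<^bsub>V\<^esub> v) = c \<odot>\<^bsub>W\<^esub> h u v)"

text \<open>The record \<^typ>\<open>('f, 'a) module\<close> extends the ring record, so its \<^const>\<open>mult\<close> serves as the
  (neither associative nor unital) multiplication of an algebra; the field \<^const>\<open>one\<close> of the
  record is left unconstrained and is never used.\<close>

locale galt_algebra = field F + module F A for F (structure) and A (structure) +
  assumes mult_bilinear: "bilinear_map F A A A (\<otimes>\<^bsub>A\<^esub>)"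
    and galt_left: "\<lbrakk>x \<in> carrier A; y \<in> carrier A; z \<in> carrier A\<rbrakk> \<Longrightarrow>
      x \<otimes>\<^bsub>A\<^esub> (y \<otimes>\<^bsub>A\<^esub> z) =
      (x \<otimes>\<^bsub>A\<^esub> y) \<otimes>\<^bsub>A\<^esub> z \<oplus>\<^bsub>A\<^esub> (y \<otimes>\<^bsub>A\<^esub> x) \<otimes>\<^bsub>A\<^esub> z \<ominus>\<^bsub>A\<^esub> y \<otimes>\<^bsub>A\<^esub> (x \<otimes>\<^bsub>A\<^esub> z)"
    and galt_right: "\<lbrakk>x \<in> carrier A; y \<in> carrier A; z \<in> carrier A\<rbrakk> \<Longrightarrow>
      (x \<otimes>\<^bsub>A\<^esub> y) \<otimes>\<^bsub>A\<^esub> z =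
      x \<otimes>\<^bsub>A\<^esub> (y \<otimes>\<^bsub>A\<^esub> z) \<oplus>\<^bsub>A\<^esub> x \<otimes>\<^bsub>A\<^esub> (z \<otimes>\<^bsub>A\<^esub> y) \<ominus>\<^bsub>A\<^esub> (x \<otimes>\<^bsub>A\<^esub> z) \<otimes>\<^bsub>A\<^esub> y"

text \<open>Here \<open>l b a\<close> is the left action \<open>ba\<close> and \<open>r a b\<close> is the right action \<open>ab\<close>.\<close>

definition derived_action ::
  "('f, 'm) ring_scheme \<Rightarrow> ('f, 'b, 'p) module_scheme \<Rightarrow> ('f, 'a, 'q) module_scheme \<Rightarrow>
   ('b \<Rightarrow> 'a \<Rightarrow> 'a) \<Rightarrow> ('a \<Rightarrow> 'b \<Rightarrow> 'a) \<Rightarrow> bool" where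
  "derived_action F B A l r \<longleftrightarrow>
     bilinear_map F B A A l \<and> bilinear_map F A B A r \<and>
     (\<forall>b\<in>carrier B. \<forall>a1\<in>carrier A. \<forall>a2\<in>carrier A.
        l b (a1 \<otimes>\<^bsub>A\<^esub> a2) = l b a1 \<otimes>\<^bsub>A\<^esub> a2 \<oplus>\<^bsub>A\<^esub> r a1 b \<otimes>\<^bsub>A\<^esub> a2 \<ominus>\<^bsub>A\<^esub> a1 \<otimes>\<^bsub>A\<^esub> l b a2 \<and>
        r (a1 \<otimes>\<^bsub>A\<^esub> a2) b = a1 \<otimes>\<^bsub>A\<^esub> r a2 b \<oplus>\<^bsub>A\<^esub> a1 \<otimes>\<^bsub>A\<^esub> l b a2 \<ominus>\<^bsub>A\<^esub> r a1 b \<otimes>\<^bsub>A\<^esub> a2 \<and>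
        l b a1 \<otimes>\<^bsub>A\<^esub> a2 = l b (a1 \<otimes>\<^bsub>A\<^esub> a2) \<oplus>\<^bsub>A\<^esub> l b (a2 \<otimes>\<^bsub>A\<^esub> a1) \<ominus>\<^bsub>A\<^esub> l b a2 \<otimes>\<^bsub>A\<^esub> a1 \<and>
        a1 \<otimes>\<^bsub>A\<^esub> r a2 b = r (a1 \<otimes>\<^bsub>A\<^esub> a2) b \<oplus>\<^bsub>A\<^esub> r (a2 \<otimes>\<^bsub>A\<^esub> a1) b \<ominus>\<^bsub>A\<^esub> a2 \<otimes>\<^bsub>A\<^esub> r a1 b) \<and>
     (\<forall>b1\<in>carrier B. \<forall>b2\<in>carrier B. \<forall>a\<in>carrier A.
        l (b1 \<otimes>\<^bsub>B\<^esub> b2) a = l b1 (l b2 a) \<oplus>\<^bsub>A\<^esub> l b1 (r a b2) \<ominus>\<^bsub>A\<^esub> r (l b1 a) b2 \<and>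
        r a (b1 \<otimes>\<^bsub>B\<^esub> b2) = r (r a b1) b2 \<oplus>\<^bsub>A\<^esub> r (l b1 a) b2 \<ominus>\<^bsub>A\<^esub> l b1 (r a b2) \<and>
        r (r a b1) b2 = r a (b1 \<otimes>\<^bsub>B\<^esub> b2) \<oplus>\<^bsub>A\<^esub> r a (b2 \<otimes>\<^bsub>B\<^esub> b1) \<ominus>\<^bsub>A\<^esub> r (r a b2) b1 \<and>
        l b1 (l b2 a) = l (b1 \<otimes>\<^bsub>B\<^esub> b2) a \<oplus>\<^bsub>A\<^esub> l (b2 \<otimes>\<^bsub>B\<^esub> b1) a \<ominus>\<^bsub>A\<^esub> l b2 (l b1 a))"

text \<open>The family \<open>B\<^sub>i\<close> ranges over all g-alternative algebras acting on \<open>A\<close>, a proper class. A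
  definition in HOL has to fix one type in which the algebras live. This is no restriction
  here: every element \<open>b\<close> of an algebra lies in the subalgebra generated by \<open>b\<close>, which is a
  g-alternative algebra acting on \<open>A\<close> and in which each element is the value of an expression
  in \<open>b\<close>; choosing one expression for each element gives an isomorphic algebra carried by a set
  of expressions. The lemma \<open>acting_pair_any_type\<close> below proves that the algebras over all
  other types contribute no further pairs.\<close>

datatype 'f gen_expr =
    Gen
  | Smul 'f "'f gen_expr"
  | Plus "'f gen_expr" "'f gen_expr"
  | Times "'f gen_expr" "'f gen_expr"

text \<open>A pair of maps \<open>f\<close> has values \<open>fa = fst f a\<close> and \<open>af = snd f a\<close>. Both maps are restricted to
  the carrier of \<open>A\<close>, so that pairs with the same values on \<open>A\<close> are equal.\<close>

type_synonym 'a map_pair = "('a \<Rightarrow> 'a) \<times> ('a \<Rightarrow> 'a)"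

definition acting_pair ::
  "('f, 'a, 'q) module_scheme \<Rightarrow> ('b \<Rightarrow> 'a \<Rightarrow> 'a) \<Rightarrow> ('a \<Rightarrow> 'b \<Rightarrow> 'a) \<Rightarrow> 'b \<Rightarrow> 'a map_pair" where
  "acting_pair A l r b = (\<lambda>a\<in>carrier A. l b a, \<lambda>a\<in>carrier A. r a b)"

definition acting_pairs ::
  "('f, 'm) ring_scheme \<Rightarrow> ('f, 'a, 'q) module_scheme \<Rightarrow> 'a map_pair set" where
  "acting_pairs F A = {acting_pair A l r b | (B :: ('f, 'f gen_expr) module) l r b.
     galt_algebra F B \<and> derived_action F B A l r \<and> b \<in> carrier B}"

definition pair_add :: "('f, 'a, 'q) module_scheme \<Rightarrow> 'a map_pair \<Rightarrow> 'a map_pair \<Rightarrow> 'a map_pair" where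
  "pair_add A f g =
     (\<lambda>a\<in>carrier A. fst f a \<oplus>\<^bsub>A\<^esub> fst g a, \<lambda>a\<in>carrier A. snd f a \<oplus>\<^bsub>A\<^esub> snd g a)"

definition pair_neg :: "('f, 'a, 'q) module_scheme \<Rightarrow> 'a map_pair \<Rightarrow> 'a map_pair" where
  "pair_neg A f = (\<lambda>a\<in>carrier A. \<ominus>\<^bsub>A\<^esub> fst f a, \<lambda>a\<in>carrier A. \<ominus>\<^bsub>A\<^esub> snd f a)"

text \<open>\<open>(fg)a = f(ga) + f(ag) - (fa)g\<close> and \<open>a(fg) = (af)g + (fa)g - f(ag)\<close>.\<close>

definition pair_mult :: "('f, 'a, 'q) module_scheme \<Rightarrow> 'a map_pair \<Rightarrow> 'a map_pair \<Rightarrow> 'a map_pair" where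
  "pair_mult A f g =
     (\<lambda>a\<in>carrier A. fst f (fst g a) \<oplus>\<^bsub>A\<^esub> fst f (snd g a) \<ominus>\<^bsub>A\<^esub> snd g (fst f a),
      \<lambda>a\<in>carrier A. snd g (snd f a) \<oplus>\<^bsub>A\<^esub> snd g (fst f a) \<ominus>\<^bsub>A\<^esub> fst f (snd g a))"

text \<open>The underlying set of the universal strict general actor of \<open>A\<close>.\<close>

inductive_set general_actor ::
  "('f, 'm) ring_scheme \<Rightarrow> ('f, 'a, 'q) module_scheme \<Rightarrow> 'a map_pair set"
  for F :: "('f, 'm) ring_scheme" and A :: "('f, 'a, 'q) module_scheme" where
  base: "f \<in> acting_pairs F A \<Longrightarrow> f \<in> general_actor F A"
| add: "\<lbrakk>f \<in> general_actor F A; g \<in> general_actor F A\<rbrakk> \<Longrightarrow> pair_add A f g \<in> general_actor F A"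
| neg: "f \<in> general_actor F A \<Longrightarrow> pair_neg A f \<in> general_actor F A"
| mult: "\<lbrakk>f \<in> general_actor F A; g \<in> general_actor F A\<rbrakk> \<Longrightarrow> pair_mult A f g \<in> general_actor F A"

definition actor_substructure ::
  "('f, 'm) ring_scheme \<Rightarrow> ('f, 'a, 'q) module_scheme \<Rightarrow> 'a set \<Rightarrow> bool" where
  "actor_substructure F A S \<longleftrightarrow>
     submodule S F A \<and>
     (\<forall>x\<in>S. \<forall>y\<in>S. x \<otimes>\<^bsub>A\<^esub> y \<in> S) \<and>
     (\<forall>f\<in>general_actor F A. \<forall>a\<in>S. fst f a \<in> S \<and> snd f a \<in> S)"

text \<open>The elements \<open>x(yz) + x(zy)\<close> and \<open>(yz)x + (zy)x\<close> with, in this order, \<open>x\<close>, \<open>y\<close> or \<open>z\<close> an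
  acting element \<open>f\<close>. Only the maps \<open>a \<mapsto> fa\<close> and \<open>a \<mapsto> af\<close> of the acting element enter.\<close>

definition soci_generators ::
  "('f, 'm) ring_scheme \<Rightarrow> ('f, 'a, 'q) module_scheme \<Rightarrow> 'a set" where
  "soci_generators F A = (\<Union>f\<in>acting_pairs F A. \<Union>u\<in>carrier A. \<Union>v\<in>carrier A.
     {fst f (u \<otimes>\<^bsub>A\<^esub> v) \<oplus>\<^bsub>A\<^esub> fst f (v \<otimes>\<^bsub>A\<^esub> u),
      snd f (u \<otimes>\<^bsub>A\<^esub> v) \<oplus>\<^bsub>A\<^esub> snd f (v \<otimes>\<^bsub>A\<^esub> u),
      u \<otimes>\<^bsub>A\<^esub> fst f v \<oplus>\<^bsub>A\<^esub> u \<otimes>\<^bsub>A\<^esub> snd f v,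
      fst f v \<otimes>\<^bsub>A\<^esub> u \<oplus>\<^bsub>A\<^esub> snd f v \<otimes>\<^bsub>A\<^esub> u,
      u \<otimes>\<^bsub>A\<^esub> snd f v \<oplus>\<^bsub>A\<^esub> u \<otimes>\<^bsub>A\<^esub> fst f v,
      snd f v \<otimes>\<^bsub>A\<^esub> u \<oplus>\<^bsub>A\<^esub> fst f v \<otimes>\<^bsub>A\<^esub> u})"

definition Soci :: "('f, 'm) ring_scheme \<Rightarrow> ('f, 'a, 'q) module_scheme \<Rightarrow> 'a set" where
  "Soci F A = \<Inter>{S. actor_substructure F A S \<and> soci_generators F A \<subseteq> S}"

definition Asoci_n :: "('f, 'm) ring_scheme \<Rightarrow> ('f, 'a, 'q) module_scheme \<Rightarrow> nat \<Rightarrow> 'a set" where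
  "Asoci_n F A n = {x \<in> carrier A.
     \<forall>as. length as = n \<and> set as \<subseteq> carrier A \<longrightarrow> foldl (\<otimes>\<^bsub>A\<^esub>) x as \<in> Soci F A}"

definition Asoci :: "('f, 'm) ring_scheme \<Rightarrow> ('f, 'a, 'q) module_scheme \<Rightarrow> 'a set" where
  "Asoci F A = (\<Union>n\<in>{1..}. Asoci_n F A n)"


subsection \<open>Algebras over arbitrary types\<close>

primrec expr_val :: "('f, 'b, 'p) module_scheme \<Rightarrow> 'b \<Rightarrow> 'f gen_expr \<Rightarrow> 'b" where
  "expr_val B b Gen = b"
| "expr_val B b (Smul c e) = c \<odot>\<^bsub>B\<^esub> expr_val B b e"
| "expr_val B b (Plus e e') = expr_val B b e \<oplus>\<^bsub>B\<^esub> expr_val B b e'"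
| "expr_val B b (Times e e') = expr_val B b e \<otimes>\<^bsub>B\<^esub> expr_val B b e'"

lemma ball_forward:
  "\<lbrakk>\<forall>x\<in>X. P x; \<And>x. x \<in> Y \<Longrightarrow> x \<in> X; \<And>x. x \<in> Y \<Longrightarrow> P x \<Longrightarrow> Q x\<rbrakk> \<Longrightarrow> \<forall>x\<in>Y. Q x"
  by blast

lemma acting_pair_any_type:
  fixes B :: "('f, 'b, 'p) module_scheme" and A :: "('f, 'a, 'q) module_scheme"
  assumes B: "galt_algebra F B" and act: "derived_action F B A l r" and b: "b \<in> carrier B"
  shows "acting_pair A l r b \<in> acting_pairs F A"
proof -
  interpret B: galt_algebra F B by (rule B)
  define E where "E = {e. set_gen_expr e \<subseteq> carrier F}"
  define v where "v = expr_val B b"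
  define S where "S = v ` E"
  define h where "h = inv_into E v"
  have clm: "\<And>x y. x \<in> carrier B \<Longrightarrow> y \<in> carrier B \<Longrightarrow> x \<otimes>\<^bsub>B\<^esub> y \<in> carrier B"
    using B.mult_bilinear unfolding bilinear_map_def by blast
  have vcl: "v e \<in> carrier B" if "e \<in> E" for e
    using that unfolding v_def E_def by (induction e) (auto simp: b clm)
  then have SB: "x \<in> carrier B" if "x \<in> S" for x using that by (auto simp: S_def)
  have EI: "Gen \<in> E" "\<And>c e. c \<in> carrier F \<Longrightarrow> e \<in> E \<Longrightarrow> Smul c e \<in> E"
    "\<And>e e'. e \<in> E \<Longrightarrow> e' \<in> E \<Longrightarrow> Plus e e' \<in> E" "\<And>e e'. e \<in> E \<Longrightarrow> e' \<in> E \<Longrightarrow> Times e e' \<in> E"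
    by (auto simp: E_def)
  have S_gen: "b \<in> S" unfolding S_def v_def by (rule image_eqI[OF _ EI(1)]) simp
  have S_smult: "c \<odot>\<^bsub>B\<^esub> x \<in> S" if c: "c \<in> carrier F" and x: "x \<in> S" for c x
  proof -
    obtain e where e: "e \<in> E" "x = v e" using x by (auto simp: S_def)
    show ?thesis unfolding S_def
      by (rule image_eqI[of _ _ "Smul c e"]) (use e c EI in \<open>simp_all add: v_def\<close>)
  qed
  have S_add: "x \<oplus>\<^bsub>B\<^esub> y \<in> S" if xy: "x \<in> S" "y \<in> S" for x y
  proof -
    obtain e e' where e: "e \<in> E" "x = v e" "e' \<in> E" "y = v e'" using xy by (auto simp: S_def)
    show ?thesis unfolding S_def
      by (rule image_eqI[of _ _ "Plus e e'"]) (use e EI in \<open>simp_all add: v_def\<close>)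
  qed
  have S_mult: "x \<otimes>\<^bsub>B\<^esub> y \<in> S" if xy: "x \<in> S" "y \<in> S" for x y
  proof -
    obtain e e' where e: "e \<in> E" "x = v e" "e' \<in> E" "y = v e'" using xy by (auto simp: S_def)
    show ?thesis unfolding S_def
      by (rule image_eqI[of _ _ "Times e e'"]) (use e EI in \<open>simp_all add: v_def\<close>)
  qed
  have S_zero: "\<zero>\<^bsub>B\<^esub> \<in> S" using S_smult[of "\<zero>\<^bsub>F\<^esub>", OF _ S_gen] b by simp
  have S_neg: "\<ominus>\<^bsub>B\<^esub> x \<in> S" if "x \<in> S" for x
    using S_smult[of "\<ominus>\<^bsub>F\<^esub> \<one>\<^bsub>F\<^esub>", OF _ that] SB[OF that] by (simp add: B.smult_l_minus)
  have vh: "v (h x) = x" if "x \<in> S" for x using that unfolding h_def S_def by (rule f_inv_into_f)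
  define C :: "('f, 'f gen_expr) module" where
    "C = \<lparr>carrier = h ` S, monoid.mult = (\<lambda>x y. h (v x \<otimes>\<^bsub>B\<^esub> v y)), one = undefined,
          zero = h \<zero>\<^bsub>B\<^esub>, add = (\<lambda>x y. h (v x \<oplus>\<^bsub>B\<^esub> v y)), smult = (\<lambda>c x. h (c \<odot>\<^bsub>B\<^esub> v x))\<rparr>"
  have C_simps: "carrier C = h ` S" "\<And>x y. x \<otimes>\<^bsub>C\<^esub> y = h (v x \<otimes>\<^bsub>B\<^esub> v y)" "\<zero>\<^bsub>C\<^esub> = h \<zero>\<^bsub>B\<^esub>"
     "\<And>x y. x \<oplus>\<^bsub>C\<^esub> y = h (v x \<oplus>\<^bsub>B\<^esub> v y)" "\<And>c x. c \<odot>\<^bsub>C\<^esub> x = h (c \<odot>\<^bsub>B\<^esub> v x)"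
    by (simp_all add: C_def)
  note S_simps = vh S_smult S_add S_mult S_zero S_neg SB clm
  have ab: "abelian_group C"
  proof (rule abelian_groupI)
    fix x assume "x \<in> carrier C"
    then obtain s where s: "s \<in> S" "x = h s" by (auto simp: C_simps)
    show "\<exists>y\<in>carrier C. y \<oplus>\<^bsub>C\<^esub> x = \<zero>\<^bsub>C\<^esub>"
      by (rule bexI[of _ "h (\<ominus>\<^bsub>B\<^esub> s)"]) (use s in \<open>simp_all add: C_simps S_simps B.l_neg\<close>)
  qed (auto simp: C_simps S_simps B.a_ac)
  have mod: "module F C"
    by (rule moduleI)
      (auto simp: C_simps S_simps ab B.is_cring B.smult_l_distr B.smult_r_distr B.smult_assoc1)
  interpret C: module F C by (rule mod)
  have C_neg: "\<ominus>\<^bsub>C\<^esub> (h x) = h (\<ominus>\<^bsub>B\<^esub> x)" if "x \<in> S" for x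
    by (rule C.minus_equality) (use that in \<open>simp_all add: C_simps S_simps B.l_neg\<close>)
  have C_minus: "h x \<ominus>\<^bsub>C\<^esub> h y = h (x \<ominus>\<^bsub>B\<^esub> y)" if "x \<in> S" "y \<in> S" for x y
    using that by (simp add: a_minus_def C_neg S_simps C_simps(4))
  have C_mult: "h x \<otimes>\<^bsub>C\<^esub> h y = h (x \<otimes>\<^bsub>B\<^esub> y)" and C_add: "h x \<oplus>\<^bsub>C\<^esub> h y = h (x \<oplus>\<^bsub>B\<^esub> y)"
    if "x \<in> S" "y \<in> S" for x y
    using that by (simp_all add: C_simps vh)
  have bil: "bilinear_map F C C C (\<otimes>\<^bsub>C\<^esub>)"
    using B.mult_bilinear unfolding bilinear_map_def by (auto simp: C_simps S_simps)
  have galt: "galt_algebra F C"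
  proof (intro galt_algebra.intro galt_algebra_axioms.intro)
    show "field F" by (rule B.field_axioms)
    show "module F C" by (rule mod)
    show "bilinear_map F C C C (\<otimes>\<^bsub>C\<^esub>)" by (rule bil)
  next
    fix x y z assume "x \<in> carrier C" "y \<in> carrier C" "z \<in> carrier C"
    then obtain s t u where "s \<in> S" "x = h s" "t \<in> S" "y = h t" "u \<in> S" "z = h u"
      by (auto simp: C_simps)
    note stu = this
    have eqs: "h (s \<otimes>\<^bsub>B\<^esub> (t \<otimes>\<^bsub>B\<^esub> u)) = h ((s \<otimes>\<^bsub>B\<^esub> t) \<otimes>\<^bsub>B\<^esub> u \<oplus>\<^bsub>B\<^esub> (t \<otimes>\<^bsub>B\<^esub> s) \<otimes>\<^bsub>B\<^esub> u \<ominus>\<^bsub>B\<^esub> t \<otimes>\<^bsub>B\<^esub> (s \<otimes>\<^bsub>B\<^esub> u))"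
      "h ((s \<otimes>\<^bsub>B\<^esub> t) \<otimes>\<^bsub>B\<^esub> u) = h (s \<otimes>\<^bsub>B\<^esub> (t \<otimes>\<^bsub>B\<^esub> u) \<oplus>\<^bsub>B\<^esub> s \<otimes>\<^bsub>B\<^esub> (u \<otimes>\<^bsub>B\<^esub> t) \<ominus>\<^bsub>B\<^esub> (s \<otimes>\<^bsub>B\<^esub> u) \<otimes>\<^bsub>B\<^esub> t)"
      using B.galt_left[of s t u] B.galt_right[of s t u] stu SB by metis+
    show "x \<otimes>\<^bsub>C\<^esub> (y \<otimes>\<^bsub>C\<^esub> z) = (x \<otimes>\<^bsub>C\<^esub> y) \<otimes>\<^bsub>C\<^esub> z \<oplus>\<^bsub>C\<^esub> (y \<otimes>\<^bsub>C\<^esub> x) \<otimes>\<^bsub>C\<^esub> z \<ominus>\<^bsub>C\<^esub> y \<otimes>\<^bsub>C\<^esub> (x \<otimes>\<^bsub>C\<^esub> z)"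
      using stu by (simp add: C_mult C_add C_minus S_mult S_add eqs(1))
    show "(x \<otimes>\<^bsub>C\<^esub> y) \<otimes>\<^bsub>C\<^esub> z = x \<otimes>\<^bsub>C\<^esub> (y \<otimes>\<^bsub>C\<^esub> z) \<oplus>\<^bsub>C\<^esub> x \<otimes>\<^bsub>C\<^esub> (z \<otimes>\<^bsub>C\<^esub> y) \<ominus>\<^bsub>C\<^esub> (x \<otimes>\<^bsub>C\<^esub> z) \<otimes>\<^bsub>C\<^esub> y"
      using stu by (simp add: C_mult C_add C_minus S_mult S_add eqs(2))
  qed
  have ball_h: "(\<forall>x\<in>h ` S. P x) \<longleftrightarrow> (\<forall>s\<in>S. P (h s))" for P by blast
  have act': "derived_action F C A (\<lambda>x. l (v x)) (\<lambda>a x. r a (v x))"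
    unfolding derived_action_def bilinear_map_def C_simps ball_h
    apply (simp only: vh S_mult S_add S_smult cong: ball_cong)
    using act[unfolded derived_action_def bilinear_map_def]
    apply (elim conj_forward ball_forward)
                        apply (assumption | erule SB)+
    done
  have "acting_pair A l r b = acting_pair A (\<lambda>x. l (v x)) (\<lambda>a x. r a (v x)) (h b)"
    by (simp add: acting_pair_def vh S_gen)
  moreover have "h b \<in> carrier C" by (simp add: C_simps S_gen)
  ultimately show ?thesis unfolding acting_pairs_def using galt act' by blast
qed

end

theory Submission
  imports Defs
begin

text \<open>Modulo \<open>Soci A\<close> the axiom for \<open>(xa)f\<close> becomes \<open>(xf)a \<equiv> -(xa)f\<close>, because
  \<open>x(af) + x(fa)\<close> is a generator of \<open>Soci A\<close>. Hence an acting element can be moved to the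
  outside: \<open>(\<dots>((xf)a\<^sub>1)\<dots>)a\<^sub>n \<equiv> \<plusminus>((\<dots>(xa\<^sub>1)\<dots>)a\<^sub>n)f\<close>, and the right-hand side lies in
  \<open>Soci A\<close> for \<open>x\<close> in \<open>Asoci\<^sup>n A\<close>. The left action reduces to the right one, as
  \<open>(fx)a + (xf)a\<close> is a generator too and \<open>n \<ge> 1\<close>.\<close>

context galt_algebra
begin

section \<open>Iterated right products and submodules of \<open>A\<close>\<close>

lemma mult_closed [simp]: "\<lbrakk>x \<in> carrier A; y \<in> carrier A\<rbrakk> \<Longrightarrow> x \<otimes>\<^bsub>A\<^esub> y \<in> carrier A"
  using mult_bilinear unfolding bilinear_map_def by blast

lemma mult_add_left:
  "\<lbrakk>x \<in> carrier A; y \<in> carrier A; z \<in> carrier A\<rbrakk> \<Longrightarrow>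
    (x \<oplus>\<^bsub>A\<^esub> y) \<otimes>\<^bsub>A\<^esub> z = x \<otimes>\<^bsub>A\<^esub> z \<oplus>\<^bsub>A\<^esub> y \<otimes>\<^bsub>A\<^esub> z"
  using mult_bilinear unfolding bilinear_map_def by blast

lemma smult_mult_left:
  "\<lbrakk>c \<in> carrier F; x \<in> carrier A; y \<in> carrier A\<rbrakk> \<Longrightarrow>
    (c \<odot>\<^bsub>A\<^esub> x) \<otimes>\<^bsub>A\<^esub> y = c \<odot>\<^bsub>A\<^esub> (x \<otimes>\<^bsub>A\<^esub> y)"
  using mult_bilinear unfolding bilinear_map_def by blast

lemma foldl_mult_closed:
  "\<lbrakk>x \<in> carrier A; set as \<subseteq> carrier A\<rbrakk> \<Longrightarrow> foldl (\<otimes>\<^bsub>A\<^esub>) x as \<in> carrier A"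
  by (induction as arbitrary: x) auto

lemma foldl_mult_add:
  "\<lbrakk>x \<in> carrier A; y \<in> carrier A; set as \<subseteq> carrier A\<rbrakk> \<Longrightarrow>
    foldl (\<otimes>\<^bsub>A\<^esub>) (x \<oplus>\<^bsub>A\<^esub> y) as = foldl (\<otimes>\<^bsub>A\<^esub>) x as \<oplus>\<^bsub>A\<^esub> foldl (\<otimes>\<^bsub>A\<^esub>) y as"
  by (induction as arbitrary: x y) (auto simp: mult_add_left)

lemma foldl_mult_smult:
  "\<lbrakk>c \<in> carrier F; x \<in> carrier A; set as \<subseteq> carrier A\<rbrakk> \<Longrightarrow>
    foldl (\<otimes>\<^bsub>A\<^esub>) (c \<odot>\<^bsub>A\<^esub> x) as = c \<odot>\<^bsub>A\<^esub> foldl (\<otimes>\<^bsub>A\<^esub>) x as"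
  by (induction as arbitrary: x) (auto simp: smult_mult_left)

text \<open>Negation is scaling by -1, and zero is \<open>x\<close> plus its negative for any
  \<open>x\<close> in the nonempty set, so closure under sums and scaling is enough.\<close>

lemma submodule_if_closed:
  assumes "S \<subseteq> carrier A" "S \<noteq> {}"
    and add: "\<And>x y. \<lbrakk>x \<in> S; y \<in> S\<rbrakk> \<Longrightarrow> x \<oplus>\<^bsub>A\<^esub> y \<in> S"
    and smult: "\<And>c x. \<lbrakk>c \<in> carrier F; x \<in> S\<rbrakk> \<Longrightarrow> c \<odot>\<^bsub>A\<^esub> x \<in> S"
  shows "submodule S F A"
proof (rule submoduleI)
  have neg: "\<ominus>\<^bsub>A\<^esub> x \<in> S" if "x \<in> S" for x
    using smult[of "\<ominus>\<^bsub>F\<^esub> \<one>\<^bsub>F\<^esub>", OF _ that] subsetD[OF assms(1) that]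
    by (simp add: smult_l_minus)
  then show "\<And>x. x \<in> S \<Longrightarrow> \<ominus>\<^bsub>A\<^esub> x \<in> S" .
  obtain x where "x \<in> S" using assms(2) by blast
  then show "\<zero>\<^bsub>A\<^esub> \<in> S" using add neg assms(1) by (metis M.r_neg subsetD)
qed (use assms in auto)

section \<open>Acting pairs and the universal strict general actor\<close>

lemma derived_action_self: "derived_action F A A (\<otimes>\<^bsub>A\<^esub>) (\<otimes>\<^bsub>A\<^esub>)"
  unfolding derived_action_def
  by (intro conjI ballI mult_bilinear galt_left galt_right) assumption+

text \<open>Every element of \<open>A\<close> counts as an acting element, so a set that all acting
  pairs preserve absorbs multiplication by \<open>A\<close>. The change from the type of
  \<open>A\<close> to \<open>gen_expr\<close> is handled by
  \<open>acting_pair_any_type\<close>.\<close>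

lemma acting_pairs_self:
  assumes "a \<in> carrier A"
  shows "acting_pair A (\<otimes>\<^bsub>A\<^esub>) (\<otimes>\<^bsub>A\<^esub>) a \<in> acting_pairs F A"
  using galt_algebra_axioms derived_action_self assms by (rule acting_pair_any_type)

lemma acting_pairs_closed:
  assumes "f \<in> acting_pairs F A" "a \<in> carrier A"
  shows "fst f a \<in> carrier A" "snd f a \<in> carrier A"
proof -
  obtain B :: "('a, 'a gen_expr) module" and l r b where
    f: "f = acting_pair A l r b" and act: "derived_action F B A l r" and b: "b \<in> carrier B"
    using assms(1) unfolding acting_pairs_def by blast
  have "bilinear_map F B A A l" "bilinear_map F A B A r"
    using act unfolding derived_action_def by simp_all
  then have "l b a \<in> carrier A" "r a b \<in> carrier A"
    using b assms(2) unfolding bilinear_map_def by simp_all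
  then show "fst f a \<in> carrier A" "snd f a \<in> carrier A"
    using assms(2) by (simp_all add: f acting_pair_def)
qed

lemma acting_pairs_snd_mult:
  assumes "f \<in> acting_pairs F A" "x \<in> carrier A" "a \<in> carrier A"
  shows "snd f (x \<otimes>\<^bsub>A\<^esub> a) = x \<otimes>\<^bsub>A\<^esub> snd f a \<oplus>\<^bsub>A\<^esub> x \<otimes>\<^bsub>A\<^esub> fst f a \<ominus>\<^bsub>A\<^esub> snd f x \<otimes>\<^bsub>A\<^esub> a"
proof -
  obtain B :: "('a, 'a gen_expr) module" and l r b where
    f: "f = acting_pair A l r b" and "derived_action F B A l r" "b \<in> carrier B"
    using assms(1) unfolding acting_pairs_def by blast
  then have "r (x \<otimes>\<^bsub>A\<^esub> a) b = x \<otimes>\<^bsub>A\<^esub> r a b \<oplus>\<^bsub>A\<^esub> x \<otimes>\<^bsub>A\<^esub> l b a \<ominus>\<^bsub>A\<^esub> r x b \<otimes>\<^bsub>A\<^esub> a"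
    using assms(2,3) unfolding derived_action_def by blast
  then show ?thesis
    using assms(2,3) by (simp add: f acting_pair_def)
qed

text \<open>Values of a sum, negative or product of pairs arise from values of the given pairs by
  composition, addition and negation, all of which stay in a submodule. Invariance thus needs
  checking on acting pairs only.\<close>

lemma general_actor_preserves:
  assumes "f \<in> general_actor F A" and S: "submodule S F A"
    and base: "\<And>f a. \<lbrakk>f \<in> acting_pairs F A; a \<in> S\<rbrakk> \<Longrightarrow> fst f a \<in> S \<and> snd f a \<in> S"
    and "a \<in> S"
  shows "fst f a \<in> S \<and> snd f a \<in> S"
proof -
  have SA: "x \<in> carrier A" if "x \<in> S" for x
    using submoduleE(1)[OF S] that by blast
  note S_closed = submoduleE(3,5)[OF S]
  show ?thesis
    using assms(1,4)
    by (induction arbitrary: a)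
      (auto simp: base SA S_closed pair_add_def pair_neg_def pair_mult_def a_minus_def)
qed

section \<open>The substructure \<open>Soci\<close>\<close>

lemma actor_substructure_carrier: "actor_substructure F A (carrier A)"
proof -
  have "submodule (carrier A) F A"
    by (rule submodule_if_closed) auto
  then show ?thesis
    using general_actor_preserves acting_pairs_closed
    unfolding actor_substructure_def by auto
qed

lemma soci_generators_carrier: "soci_generators F A \<subseteq> carrier A"
  unfolding soci_generators_def
  by (intro UN_least) (simp add: acting_pairs_closed)

lemma actor_substructure_Soci: "actor_substructure F A (Soci F A)"
proof -
  let ?\<S> = "{S. actor_substructure F A S \<and> soci_generators F A \<subseteq> S}"
  \<comment> \<open>A member of the family is needed to bound the intersection: over an empty family
    it would be the whole type.\<close>
  have "carrier A \<in> ?\<S>"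
    using actor_substructure_carrier soci_generators_carrier by simp
  then have "Soci F A \<subseteq> carrier A"
    unfolding Soci_def by blast
  moreover have "\<zero>\<^bsub>A\<^esub> \<in> S" if "S \<in> ?\<S>" for S
    using that by (auto simp: actor_substructure_def submodule_def
        dest: subgroup.one_closed)
  then have "Soci F A \<noteq> {}"
    unfolding Soci_def by blast
  ultimately have "submodule (Soci F A) F A"
    by (rule submodule_if_closed)
      (auto simp: Soci_def actor_substructure_def submoduleE(4,5))
  then show ?thesis
    unfolding actor_substructure_def by (auto simp: Soci_def actor_substructure_def)
qed

lemma Soci_submodule: "submodule (Soci F A) F A"
  using actor_substructure_Soci unfolding actor_substructure_def by simp

lemma Soci_carrier: "x \<in> Soci F A \<Longrightarrow> x \<in> carrier A"
  using submoduleE(1)[OF Soci_submodule] by blast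

lemmas Soci_add = submoduleE(5)[OF Soci_submodule]
lemmas Soci_neg = submoduleE(3)[OF Soci_submodule]
lemmas Soci_smult = submoduleE(4)[OF Soci_submodule]

lemma Soci_acting_pairs:
  "\<lbrakk>f \<in> acting_pairs F A; x \<in> Soci F A\<rbrakk> \<Longrightarrow> fst f x \<in> Soci F A \<and> snd f x \<in> Soci F A"
  using actor_substructure_Soci
  by (auto simp: actor_substructure_def intro: general_actor.base)

lemma Soci_generators: "soci_generators F A \<subseteq> Soci F A"
  by (auto simp: Soci_def)

text \<open>Right multiplication by \<open>a\<close> is the second map of the acting pair that
  \<open>a\<close> gives through the action of \<open>A\<close> on itself.\<close>

lemma Soci_mult_right:
  assumes "x \<in> Soci F A" "a \<in> carrier A"
  shows "x \<otimes>\<^bsub>A\<^esub> a \<in> Soci F A"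
  using Soci_acting_pairs[OF acting_pairs_self[OF assms(2)] assms(1)] Soci_carrier[OF assms(1)]
  by (simp add: acting_pair_def)

lemma foldl_mult_Soci:
  "\<lbrakk>x \<in> Soci F A; set as \<subseteq> carrier A\<rbrakk> \<Longrightarrow> foldl (\<otimes>\<^bsub>A\<^esub>) x as \<in> Soci F A"
  by (induction as arbitrary: x) (auto simp: Soci_mult_right)

section \<open>Moving an acting element outwards modulo \<open>Soci\<close>\<close>

lemma Soci_cancel:
  assumes "x \<oplus>\<^bsub>A\<^esub> y \<in> Soci F A" "y \<in> Soci F A" "x \<in> carrier A"
  shows "x \<in> Soci F A"
proof -
  have "x = (x \<oplus>\<^bsub>A\<^esub> y) \<oplus>\<^bsub>A\<^esub> \<ominus>\<^bsub>A\<^esub> y"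
    using assms Soci_carrier by (simp add: M.a_assoc M.r_neg)
  then show ?thesis
    using Soci_add[OF assms(1) Soci_neg[OF assms(2)]] by simp
qed

text \<open>Iterated right multiplication is additive and preserves \<open>Soci\<close>, so a
  relation x \<equiv> -y modulo \<open>Soci\<close> survives it; the sign does not affect
  membership.\<close>

lemma foldl_mult_Soci_transfer:
  assumes "x \<oplus>\<^bsub>A\<^esub> y \<in> Soci F A" "foldl (\<otimes>\<^bsub>A\<^esub>) y as \<in> Soci F A"
    and "x \<in> carrier A" "y \<in> carrier A" "set as \<subseteq> carrier A"
  shows "foldl (\<otimes>\<^bsub>A\<^esub>) x as \<in> Soci F A"
proof (rule Soci_cancel)
  show "foldl (\<otimes>\<^bsub>A\<^esub>) x as \<oplus>\<^bsub>A\<^esub> foldl (\<otimes>\<^bsub>A\<^esub>) y as \<in> Soci F A"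
    using foldl_mult_Soci[OF assms(1,5)] by (simp only: foldl_mult_add[OF assms(3-5)])
qed (use assms foldl_mult_closed in auto)

lemma snd_mult_Soci:
  assumes f: "f \<in> acting_pairs F A" and x: "x \<in> carrier A" and a: "a \<in> carrier A"
  shows "snd f x \<otimes>\<^bsub>A\<^esub> a \<oplus>\<^bsub>A\<^esub> snd f (x \<otimes>\<^bsub>A\<^esub> a) \<in> Soci F A"
proof -
  note cl = acting_pairs_closed[OF f x] acting_pairs_closed[OF f a] x a
  have "snd f x \<otimes>\<^bsub>A\<^esub> a \<oplus>\<^bsub>A\<^esub> snd f (x \<otimes>\<^bsub>A\<^esub> a) = x \<otimes>\<^bsub>A\<^esub> snd f a \<oplus>\<^bsub>A\<^esub> x \<otimes>\<^bsub>A\<^esub> fst f a"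
    unfolding acting_pairs_snd_mult[OF f x a]
    using cl by (simp add: a_minus_def M.a_ac M.r_neg M.r_neg1 M.r_neg2)
  \<comment> \<open>This is the fifth listed form, with \<open>u = x\<close> and
    \<open>v = a\<close>.\<close>
  also have "\<dots> \<in> soci_generators F A"
    using f x a unfolding soci_generators_def by blast
  finally show ?thesis using Soci_generators by blast
qed

text \<open>Once a factor \<open>a\<close> stands on the right, the left action can be traded for
  the right one up to sign.\<close>

lemma fst_mult_Soci:
  assumes "f \<in> acting_pairs F A" "x \<in> carrier A" "a \<in> carrier A"
  shows "fst f x \<otimes>\<^bsub>A\<^esub> a \<oplus>\<^bsub>A\<^esub> snd f x \<otimes>\<^bsub>A\<^esub> a \<in> Soci F A"
  using assms Soci_generators unfolding soci_generators_def by blast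

text \<open>Each induction step moves \<open>f\<close> past one factor by
  \<open>snd_mult_Soci\<close>. The premise for \<open>x\<close> and \<open>a # as\<close> is the
  premise for the product of \<open>x\<close> and \<open>a\<close> with the list
  \<open>as\<close>.\<close>

lemma foldl_mult_snd_Soci:
  assumes f: "f \<in> acting_pairs F A"
  shows "\<lbrakk>x \<in> carrier A; set as \<subseteq> carrier A; snd f (foldl (\<otimes>\<^bsub>A\<^esub>) x as) \<in> Soci F A\<rbrakk> \<Longrightarrow>
    foldl (\<otimes>\<^bsub>A\<^esub>) (snd f x) as \<in> Soci F A"
proof (induction as arbitrary: x)
  case (Cons a as)
  then have "foldl (\<otimes>\<^bsub>A\<^esub>) (snd f (x \<otimes>\<^bsub>A\<^esub> a)) as \<in> Soci F A"
    by simp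
  then have "foldl (\<otimes>\<^bsub>A\<^esub>) (snd f x \<otimes>\<^bsub>A\<^esub> a) as \<in> Soci F A"
    using Cons.prems
    by (intro foldl_mult_Soci_transfer[OF snd_mult_Soci[OF f]]) (auto simp: acting_pairs_closed[OF f])
  then show ?case by simp
qed simp

section \<open>Closure properties of the levels \<open>Asoci_n\<close> and of their union\<close>

lemma Asoci_n_snd:
  assumes "f \<in> acting_pairs F A" "x \<in> Asoci_n F A n"
  shows "snd f x \<in> Asoci_n F A n"
  using assms
  by (auto simp: Asoci_n_def acting_pairs_closed Soci_acting_pairs intro!: foldl_mult_snd_Soci)

lemma Asoci_n_fst:
  assumes f: "f \<in> acting_pairs F A" and x: "x \<in> Asoci_n F A n" and "n \<ge> 1"
  shows "fst f x \<in> Asoci_n F A n"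
proof -
  have xA: "x \<in> carrier A" using x by (simp add: Asoci_n_def)
  have "foldl (\<otimes>\<^bsub>A\<^esub>) (fst f x) as \<in> Soci F A"
    if as: "length as = n" "set as \<subseteq> carrier A" for as
  proof -
    \<comment> \<open>The bound on \<open>n\<close> provides the factor \<open>b\<close> that
      \<open>fst_mult_Soci\<close> requires.\<close>
    obtain b bs where bs: "as = b # bs" using as(1) \<open>n \<ge> 1\<close> by (cases as) auto
    have "foldl (\<otimes>\<^bsub>A\<^esub>) (snd f x \<otimes>\<^bsub>A\<^esub> b) bs \<in> Soci F A"
      using Asoci_n_snd[OF f x] as unfolding Asoci_n_def bs by fastforce
    then show ?thesis
      using as xA unfolding bs foldl_Cons
      by (intro foldl_mult_Soci_transfer[OF fst_mult_Soci[OF f]]) (auto simp: acting_pairs_closed[OF f])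
  qed
  then show ?thesis using xA acting_pairs_closed[OF f] by (simp add: Asoci_n_def)
qed

text \<open>The level does not rise: \<open>y\<close> and all but the last of the \<open>n\<close>
  factors already bring \<open>x\<close> into \<open>Soci\<close>, which absorbs the last
  one.\<close>

lemma Asoci_n_mult:
  assumes x: "x \<in> Asoci_n F A n" and y: "y \<in> carrier A"
  shows "x \<otimes>\<^bsub>A\<^esub> y \<in> Asoci_n F A n"
proof -
  have xA: "x \<in> carrier A" using x by (simp add: Asoci_n_def)
  have "foldl (\<otimes>\<^bsub>A\<^esub>) (x \<otimes>\<^bsub>A\<^esub> y) as \<in> Soci F A"
    if as: "length as = n" "set as \<subseteq> carrier A" for as
  proof (cases as rule: rev_cases)
    \<comment> \<open>Here \<open>n = 0\<close>, and \<open>x\<close> itself lies in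
      \<open>Soci\<close>.\<close>
    case Nil
    then show ?thesis using x y as Soci_mult_right by (auto simp: Asoci_n_def)
  next
    case (snoc bs b)
    \<comment> \<open>The fold is kept unevaluated so that it matches the membership condition for
      \<open>x\<close> with the list \<open>y # bs\<close> of length \<open>n\<close>.\<close>
    have "foldl (\<otimes>\<^bsub>A\<^esub>) x (y # bs) \<in> Soci F A"
      using x as y snoc unfolding Asoci_n_def by (auto simp del: foldl_Cons)
    then show ?thesis using as snoc by (simp add: Soci_mult_right)
  qed
  then show ?thesis using xA y by (simp add: Asoci_n_def)
qed

text \<open>The first \<open>m\<close> factors lead into \<open>Soci\<close>, and the remaining ones
  do not leave it.\<close>

lemma Asoci_n_mono:
  assumes "m \<le> n"
  shows "Asoci_n F A m \<subseteq> Asoci_n F A n"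
proof
  fix x assume x: "x \<in> Asoci_n F A m"
  have "foldl (\<otimes>\<^bsub>A\<^esub>) x as \<in> Soci F A" if as: "length as = n" "set as \<subseteq> carrier A" for as
  proof -
    have "length (take m as) = m" "set (take m as) \<subseteq> carrier A" "set (drop m as) \<subseteq> carrier A"
      using as assms set_take_subset[of m as] set_drop_subset[of m as] by auto
    then have "foldl (\<otimes>\<^bsub>A\<^esub>) (foldl (\<otimes>\<^bsub>A\<^esub>) x (take m as)) (drop m as) \<in> Soci F A"
      using x unfolding Asoci_n_def by (blast intro: foldl_mult_Soci)
    then show ?thesis by (metis append_take_drop_id foldl_append)
  qed
  then show "x \<in> Asoci_n F A n" using x by (simp add: Asoci_n_def)
qed

lemma Asoci_n_add:
  "\<lbrakk>x \<in> Asoci_n F A n; y \<in> Asoci_n F A n\<rbrakk> \<Longrightarrow> x \<oplus>\<^bsub>A\<^esub> y \<in> Asoci_n F A n"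
  by (auto simp: Asoci_n_def foldl_mult_add Soci_add)

lemma Asoci_n_smult:
  "\<lbrakk>c \<in> carrier F; x \<in> Asoci_n F A n\<rbrakk> \<Longrightarrow> c \<odot>\<^bsub>A\<^esub> x \<in> Asoci_n F A n"
  by (auto simp: Asoci_n_def foldl_mult_smult Soci_smult)

lemma Asoci_add:
  assumes "x \<in> Asoci F A" "y \<in> Asoci F A"
  shows "x \<oplus>\<^bsub>A\<^esub> y \<in> Asoci F A"
proof -
  obtain m n where "m \<ge> 1" "x \<in> Asoci_n F A m" "y \<in> Asoci_n F A n"
    using assms by (auto simp: Asoci_def)
  \<comment> \<open>The levels increase, so both summands lie in the level of the larger
    index.\<close>
  then have "x \<oplus>\<^bsub>A\<^esub> y \<in> Asoci_n F A (max m n)" "max m n \<ge> 1"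
    using Asoci_n_mono[of m "max m n"] Asoci_n_mono[of n "max m n"] by (auto intro!: Asoci_n_add)
  then show ?thesis by (auto simp: Asoci_def)
qed

lemma Asoci_submodule: "submodule (Asoci F A) F A"
proof (rule submodule_if_closed)
  show "Asoci F A \<subseteq> carrier A" by (auto simp: Asoci_def Asoci_n_def)
  \<comment> \<open>Nonemptiness is inherited from \<open>Soci\<close>, which lies in the first
    level since it absorbs right multiplication.\<close>
  have "Soci F A \<subseteq> Asoci_n F A 1"
    using foldl_mult_Soci Soci_carrier by (auto simp: Asoci_n_def)
  then show "Asoci F A \<noteq> {}"
    using submoduleE(2)[OF Soci_submodule] by (auto simp: Asoci_def)
qed (auto simp: Asoci_add, auto simp: Asoci_def intro: Asoci_n_smult)

end

theorem proposition4p5: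
  fixes F :: "('f, 'm) ring_scheme" and A :: "('f, 'a, 'n) module_scheme"
  assumes "galt_algebra F A"
  shows "actor_substructure F A (Asoci F A)"
proof -
  interpret galt_algebra F A by (rule assms)
  have acting: "fst f x \<in> Asoci F A \<and> snd f x \<in> Asoci F A"
    if "f \<in> acting_pairs F A" "x \<in> Asoci F A" for f x
    using that Asoci_n_fst Asoci_n_snd unfolding Asoci_def by fastforce
  have "x \<otimes>\<^bsub>A\<^esub> y \<in> Asoci F A" if "x \<in> Asoci F A" "y \<in> Asoci F A" for x y
  proof -
    have "y \<in> carrier A" using that(2) submoduleE(1)[OF Asoci_submodule] by blast
    then show ?thesis using that(1) Asoci_n_mult unfolding Asoci_def by blast
  qed
  then show ?thesis
    using Asoci_submodule general_actor_preserves[OF _ Asoci_submodule acting]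
    unfolding actor_substructure_def by blast
qed

end
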